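(* Let $n\geq 2$. For $1\leq p\leq \frac{n+1}{n-1}$, there exist some $f\in L^p(\mathbb{R}^n)$ and a measurable set $F\subseteq\mathbb{R}^n$ of positive $n$-dimensional Lebesgue measure such that $$\mathcal{M}_{\mathrm{st}}f(x)=\infty\qquad\text{for all }x\in F.$$
   Context: Let $\sigma$ be the surface measure on the unit sphere $S^{n-1}\subset\mathbb{R}^n$, normalised to have mass $1$. For $\mathbf{r}=(r_1,\dots,r_n)\in(0,\infty)^n$ let $\delta_{\mathbf{r}}(x_1,\dots,x_n):=(r_1x_1,\dots,r_nx_n)$ and let $\sigma_{\mathbf{r}}$ be the dilated measure defined by $\langle\sigma_{\mathbf{r}},f\rangle:=\langle\sigma,f\circ\delta_{\mathbf{r}}\rangle=\int_{S^{n-1}}f(\delta_{\mathbf{r}}\,\omega)\,d\sigma(\omega)$ for $f\in C_c(\mathbb{R}^n)$. The strong spherical maximal function is $\mathcal{M}_{\mathrm{st}}f(x):=\sup_{\mathbf{r}\in(0,\infty)^n}|f*\sigma_{\mathbf{r}}(x)|$, introduced for $f\in C_c(\mathbb{R}^n)$; the same formula is used here for $f\in L^p(\mathbb{R}^n)$. *)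

theory Defs
  imports "HOL-Probability.Probability"
begin

text \<open>
  Polar-coordinate construction of the normalised surface measure: the mass of a Borel set A
  is the proportion of the unit ball occupied by the cone over A, i.e. the image of normalised
  Lebesgue measure on the ball under x \<mapsto> x / |x|. It is a measure on the Borel sets of the
  ambient space, carried by the unit sphere (the origin, where sgn is 0, is a null set).
\<close>
definition sphere_measure :: "(real ^ 'n) measure" where
  "sphere_measure = distr (uniform_measure lborel (ball 0 1)) borel sgn"

definition dilation :: "real ^ 'n \<Rightarrow> real ^ 'n \<Rightarrow> real ^ 'n" where
  "dilation r x = (\<chi> i. r $ i * x $ i)"

definition dilated_sphere_measure :: "real ^ 'n \<Rightarrow> (real ^ 'n) measure" where
  "dilated_sphere_measure r = distr sphere_measure borel (dilation r)"

text \<open>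
  The Lebesgue integral with values in [-\<infinity>, \<infinity>], so that a divergent integral of a nonnegative
  function is \<infinity>. The Bochner integral of the library would return 0 there. The case in which
  positive and negative part both diverge, where the integral is undefined, is separated out
  because \<infinity> - \<infinity> = \<infinity> on type ereal; the value 0 means that such an average
  contributes nothing to the maximal function below.
\<close>
definition ext_integral :: "'a measure \<Rightarrow> ('a \<Rightarrow> real) \<Rightarrow> ereal" where
  "ext_integral M g =
     (let P = (\<integral>\<^sup>+ y. ennreal (g y) \<partial>M); N = (\<integral>\<^sup>+ y. ennreal (- g y) \<partial>M)
      in if P = \<infinity> \<and> N = \<infinity> then 0 else enn2ereal P - enn2ereal N)"

definition measure_convolution ::
    "(real ^ 'n \<Rightarrow> real) \<Rightarrow> (real ^ 'n) measure \<Rightarrow> real ^ 'n \<Rightarrow> ereal" where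
  "measure_convolution f \<mu> x = ext_integral \<mu> (\<lambda>y. f (x - y))"

definition strong_spherical_maximal :: "(real ^ 'n \<Rightarrow> real) \<Rightarrow> real ^ 'n \<Rightarrow> ereal" where
  "strong_spherical_maximal f x =
     (SUP r\<in>{r. \<forall>i. 0 < r $ i}. \<bar>measure_convolution f (dilated_sphere_measure r) x\<bar>)"

text \<open>
  Elements are functions, not classes modulo null sets. Borel representatives are used so that
  the restriction of f to every ellipsoid is measurable.
\<close>
definition Lp_space :: "real \<Rightarrow> (real ^ 'n \<Rightarrow> real) set" where
  "Lp_space p = {f \<in> borel_measurable borel. integrable lborel (\<lambda>x. \<bar>f x\<bar> powr p)}"

lemma measurable_dilation [measurable]: "dilation r \<in> borel_measurable borel"
  unfolding dilation_def
  by (intro borel_measurable_continuous_onI continuous_intros)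

lemma measurable_sgn_vec [measurable]:
  "(sgn :: real ^ 'n \<Rightarrow> real ^ 'n) \<in> borel_measurable borel"
  unfolding sgn_div_norm by measurable

lemma emeasure_unit_ball:
  "emeasure lborel (ball (0 :: real ^ 'n) 1) \<noteq> 0" "emeasure lborel (ball (0 :: real ^ 'n) 1) \<noteq> \<infinity>"
  using content_ball_pos[of 1 "0 :: real ^ 'n"] emeasure_lborel_ball_finite[of "0 :: real ^ 'n" 1]
  by (auto simp: measure_def)

lemma prob_space_sphere_measure: "prob_space (sphere_measure :: (real ^ 'n) measure)"
proof -
  interpret prob_space "uniform_measure lborel (ball (0 :: real ^ 'n) 1)"
    using emeasure_unit_ball by (intro prob_space_uniform_measure)
  show ?thesis
    unfolding sphere_measure_def by (rule prob_space_distr) simp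
qed

lemma emeasure_sphere_measure:
  fixes A :: "(real ^ 'n) set"
  assumes "A \<in> sets borel"
  shows "emeasure sphere_measure A =
    emeasure lborel {x \<in> ball 0 1. sgn x \<in> A} / emeasure lborel (ball (0 :: real ^ 'n) 1)"
proof -
  have m: "(sgn :: real ^ 'n \<Rightarrow> real ^ 'n) -` A \<in> sets borel"
    using measurable_sets[OF measurable_sgn_vec assms] by simp
  have "emeasure sphere_measure A =
      emeasure (uniform_measure lborel (ball 0 1)) (sgn -` A)"
    unfolding sphere_measure_def using assms by (subst emeasure_distr) auto
  also have "\<dots> = emeasure lborel (ball 0 1 \<inter> sgn -` A) / emeasure lborel (ball (0 :: real ^ 'n) 1)"
    using m by (intro emeasure_uniform_measure) auto
  also have "ball 0 1 \<inter> sgn -` A = {x \<in> ball 0 1. sgn x \<in> A}"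
    by auto
  finally show ?thesis .
qed

lemma emeasure_sphere_measure_sphere: "emeasure sphere_measure (sphere (0 :: real ^ 'n) 1) = 1"
proof -
  have "{x \<in> ball (0 :: real ^ 'n) 1. sgn x \<in> sphere 0 1} = ball 0 1 - {0}"
    by (auto simp: norm_sgn)
  moreover have "emeasure lborel (ball (0 :: real ^ 'n) 1 - {0}) = emeasure lborel (ball (0 :: real ^ 'n) 1)"
    by (intro emeasure_Diff_null_set) auto
  ultimately show ?thesis
    using emeasure_unit_ball[where 'n = 'n]
    by (subst emeasure_sphere_measure) (auto simp: ennreal_divide_self top.not_eq_extremum)
qed

lemma integral_dilated_sphere_measure:
  fixes f :: "real ^ 'n \<Rightarrow> real"
  assumes "f \<in> borel_measurable borel"
  shows "integral\<^sup>L (dilated_sphere_measure r) f = (\<integral>\<omega>. f (dilation r \<omega>) \<partial>sphere_measure)"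
  unfolding dilated_sphere_measure_def
  by (rule integral_distr) (use assms in \<open>auto simp: sphere_measure_def\<close>)

lemma ext_integral_eq_integral:
  assumes "integrable M g"
  shows "ext_integral M g = ereal (integral\<^sup>L M g)"
proof -
  obtain a b where "a \<ge> 0" "b \<ge> 0"
    "(\<integral>\<^sup>+ y. ennreal (g y) \<partial>M) = ennreal a" "(\<integral>\<^sup>+ y. ennreal (- g y) \<partial>M) = ennreal b"
    "integral\<^sup>L M g = a - b"
    using integrableE[OF assms] by metis
  then show ?thesis
    by (simp add: ext_integral_def enn2ereal_ennreal)
qed

end

theory Submission
  imports Defs
begin

text \<open>
  For every \<open>x\<close> with positive coordinates, exactly one axis-parallel ellipsoid centred at \<open>x\<close>
  passes through the origin tangentially to the hyperplane where the coordinate sum vanishes: with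
  \<open>S\<close> the coordinate sum of \<open>x\<close>, its semi-axes are \<open>r\<^sub>i = sqrt (S x\<^sub>i)\<close>. Near the origin
  it stays in the plates of thickness \<open>4\<^sup>-\<^sup>k\<close> and width \<open>2\<^sup>-\<^sup>k\<close> around this hyperplane.
  Such a plate has volume about \<open>2\<close> to the power \<open>- k (n + 1)\<close>, whereas the spherical measure of its
  trace on the ellipsoid is about \<open>2\<close> to the power \<open>- k (n - 1)\<close>. A function of size \<open>2\<close> to the
  power \<open>k (n - 1)\<close>, divided by \<open>k\<close>, on the \<open>k\<close>-th plate therefore has a divergent average,
  like the harmonic series, while the integral of its critical power \<open>s = (n + 1) / (n - 1)\<close> is
  controlled by the convergent sum of \<open>k\<close> to the power \<open>- s\<close>.
\<close>

section \<open>Packing by translates and the measure of spherical caps\<close>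

lemma emeasure_lborel_translation:
  fixes A :: "'a::euclidean_space set"
  assumes "A \<in> sets borel"
  shows "emeasure lborel {x. x - c \<in> A} = emeasure lborel A"
proof -
  have "emeasure lborel A = emeasure (distr lborel borel ((+) (- c))) A"
    by (simp add: lborel_distr_plus)
  also have "\<dots> = emeasure lborel ((+) (- c) -` A)"
    using assms by (subst emeasure_distr) auto
  also have "(+) (- c) -` A = {x. x - c \<in> A}"
    by (auto simp: algebra_simps)
  finally show ?thesis ..
qed

text \<open>Serves in two directions: balls packed into the cone over a cap bound the cone from
  below, while plates packed into a ball bound the plate from above.\<close>

lemma emeasure_disjoint_translates_le:
  fixes A B :: "'a::euclidean_space set" and c :: "nat \<Rightarrow> 'a"
  assumes A: "A \<in> sets borel" and B: "B \<in> sets borel"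
    and disj: "\<And>i j x. i < j \<Longrightarrow> j < M \<Longrightarrow> x - c i \<in> A \<Longrightarrow> x - c j \<in> A \<Longrightarrow> False"
    and sub: "\<And>j x. j < M \<Longrightarrow> x - c j \<in> A \<Longrightarrow> x \<in> B"
  shows "of_nat M * emeasure lborel A \<le> emeasure lborel B"
proof -
  let ?T = "\<lambda>j. {x. x - c j \<in> A}"
  have meas: "?T j \<in> sets borel" for j
  proof -
    have "(\<lambda>x. x - c j) \<in> borel_measurable borel"
      by measurable
    from measurable_sets[OF this A] show ?thesis
      by (simp add: vimage_def)
  qed
  have dj: "disjoint_family_on ?T {..<M}"
    unfolding disjoint_family_on_def using disj by (fastforce simp: neq_iff)
  have "of_nat M * emeasure lborel A = (\<Sum>j<M. emeasure lborel (?T j))"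
    by (simp add: emeasure_lborel_translation[OF A])
  also have "\<dots> = emeasure lborel (\<Union>j<M. ?T j)"
    using meas dj by (intro sum_emeasure) auto
  also have "\<dots> \<le> emeasure lborel B"
    using B sub by (intro emeasure_mono) auto
  finally show ?thesis .
qed

text \<open>Moving \<open>x\<close> radially to length \<open>t\<close> costs
  \<open>\<bar>t - norm x\<bar>\<close>, which is at most the distance from \<open>x\<close> to
  \<open>t *\<^sub>R u\<close>; the triangle inequality then gives the factor 2.\<close>

lemma norm_sgn_diff_le:
  fixes x u :: "'a::real_normed_vector"
  assumes "norm u = 1" "0 < t"
  shows "norm (sgn x - u) \<le> 2 * norm (x - t *\<^sub>R u) / t"
proof (cases "x = 0")
  case True
  then show ?thesis using assms by simp
next
  case False
  have "norm (t *\<^sub>R sgn x - x) = \<bar>t - norm x\<bar>"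
  proof -
    have "norm x *\<^sub>R sgn x = x"
      using False by (simp add: sgn_div_norm)
    then have "t *\<^sub>R sgn x - x = (t - norm x) *\<^sub>R sgn x"
      by (simp add: scaleR_diff_left)
    then show ?thesis using False by (simp add: norm_sgn)
  qed
  also have "\<dots> \<le> norm (x - t *\<^sub>R u)"
    using norm_triangle_ineq3[of x "t *\<^sub>R u"] assms by simp
  finally have "norm (t *\<^sub>R (sgn x - u)) \<le> 2 * norm (x - t *\<^sub>R u)"
    using norm_triangle_ineq[of "t *\<^sub>R sgn x - x" "x - t *\<^sub>R u"]
    by (simp add: scaleR_diff_right)
  moreover have "norm (t *\<^sub>R (sgn x - u)) = t * norm (sgn x - u)"
    using assms by simp
  ultimately show ?thesis
    using assms by (simp add: pos_le_divide_eq mult.commute)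
qed

text \<open>
  The cone over a cap of radius \<open>\<epsilon>\<close> contains about \<open>1 / \<epsilon>\<close> disjoint balls of radius
  comparable to \<open>\<epsilon>\<close>, centred along its axis.
\<close>
lemma sphere_measure_cap_ge:
  fixes u :: "real ^ 'n"
  assumes u: "norm u = 1" and \<epsilon>: "0 < \<epsilon>" "\<epsilon> \<le> 1"
  shows "ennreal (\<epsilon> ^ (CARD('n) - 1) / 8 ^ CARD('n)) \<le> emeasure sphere_measure {\<omega>. norm (\<omega> - u) < \<epsilon>}"
proof -
  define M where "M = nat \<lceil>1 / \<epsilon>\<rceil>"
  have M: "1 / \<epsilon> \<le> real M" "\<And>j. j < M \<Longrightarrow> real j < 1 / \<epsilon>"
    unfolding M_def by linarith+
  \<comment> \<open>The spacing \<epsilon>/4 is twice the radius \<epsilon>/8, so the open balls are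
    disjoint. Centres at distance in [1/4, 1/2) keep them inside the unit ball and bound the angular
    error by 2 (\<epsilon>/8) / (1/4) = \<epsilon>.\<close>
  define t where "t j = 1 / 4 + \<epsilon> / 4 * real j" for j :: nat
  let ?C = "{x \<in> ball (0 :: real ^ 'n) 1. sgn x \<in> {\<omega>. norm (\<omega> - u) < \<epsilon>}}"
  define V where "V = unit_ball_vol (real CARD('n))"
  have V: "V > 0" by (simp add: V_def)
  have t: "1 / 4 \<le> t j" "j < M \<Longrightarrow> t j < 1 / 2" for j
    using M(2)[of j] \<epsilon> by (auto simp: t_def field_simps)
  have "of_nat M * emeasure lborel (ball (0 :: real ^ 'n) (\<epsilon> / 8)) \<le> emeasure lborel ?C"
  proof (rule emeasure_disjoint_translates_le)
    show "?C \<in> sets borel"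
      by measurable
  next
    fix i j and x :: "real ^ 'n"
    assume ij: "i < j" "j < M" and x: "x - t i *\<^sub>R u \<in> ball 0 (\<epsilon> / 8)" "x - t j *\<^sub>R u \<in> ball 0 (\<epsilon> / 8)"
    have "t j - t i = \<epsilon> / 4 * (real j - real i)"
      by (simp add: t_def algebra_simps)
    also have "\<dots> \<ge> \<epsilon> / 4 * 1"
      using ij \<epsilon> by (intro mult_left_mono) auto
    finally have "norm ((t j - t i) *\<^sub>R u) \<ge> \<epsilon> / 4"
      using u abs_ge_self[of "t j - t i"] by (simp del: abs_ge_self)
    moreover have "(t j - t i) *\<^sub>R u = (x - t i *\<^sub>R u) - (x - t j *\<^sub>R u)"
      by (simp add: algebra_simps)
    ultimately show False
      using x norm_triangle_ineq4[of "x - t i *\<^sub>R u" "x - t j *\<^sub>R u"] by simp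
  next
    fix j and x :: "real ^ 'n"
    assume j: "j < M" and x: "x - t j *\<^sub>R u \<in> ball 0 (\<epsilon> / 8)"
    have "norm x \<le> norm (x - t j *\<^sub>R u) + norm (t j *\<^sub>R u)"
      using norm_triangle_ineq[of "x - t j *\<^sub>R u" "t j *\<^sub>R u"] by simp
    also have "\<dots> < 1"
      using x u t[of j] j \<epsilon> by simp
    finally have "norm x < 1" .
    moreover have "norm (sgn x - u) < \<epsilon>"
    proof -
      have "norm (sgn x - u) \<le> 2 * norm (x - t j *\<^sub>R u) / t j"
        using u t[of j] by (intro norm_sgn_diff_le) auto
      also have "\<dots> \<le> 2 * norm (x - t j *\<^sub>R u) / (1 / 4)"
        using t[of j] by (intro divide_left_mono) auto
      also have "\<dots> < \<epsilon>"
        using x by simp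
      finally show ?thesis .
    qed
    ultimately show "x \<in> ?C" by simp
  qed auto
  also have "of_nat M * emeasure lborel (ball (0 :: real ^ 'n) (\<epsilon> / 8)) =
      ennreal (real M * (V * (\<epsilon> / 8) ^ CARD('n)))"
    using \<epsilon> V by (simp add: emeasure_ball V_def ennreal_mult ennreal_of_nat_eq_real_of_nat)
  finally have "ennreal (real M * (V * (\<epsilon> / 8) ^ CARD('n))) / ennreal V \<le> emeasure lborel ?C / ennreal V"
    by (rule divide_right_mono_ennreal)
  also have "\<dots> = emeasure sphere_measure {\<omega>. norm (\<omega> - u) < \<epsilon>}"
    by (subst emeasure_sphere_measure) (simp_all add: emeasure_ball V_def)
  finally have *: "ennreal (real M * (\<epsilon> / 8) ^ CARD('n)) \<le> emeasure sphere_measure {\<omega>. norm (\<omega> - u) < \<epsilon>}"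
    using V \<epsilon> by (simp add: divide_ennreal)
  have "\<epsilon> ^ (CARD('n) - 1) / 8 ^ CARD('n) = 1 / \<epsilon> * (\<epsilon> / 8) ^ CARD('n)"
    using \<epsilon> by (simp add: power_divide power_eq_if[of \<epsilon> "CARD('n)"])
  also have "\<dots> \<le> real M * (\<epsilon> / 8) ^ CARD('n)"
    using M \<epsilon> by (intro mult_right_mono) auto
  finally show ?thesis
    using * by (meson ennreal_leI order_trans)
qed

section \<open>Parabolic plates and their volume\<close>

definition plate :: "nat \<Rightarrow> (real ^ 'n) set" where
  "plate k = {z. norm z < (1 / 2) ^ k \<and> \<bar>\<Sum>i\<in>UNIV. z $ i\<bar> < (1 / 4) ^ k}"

lemma plate_borel [measurable]: "plate k \<in> sets borel"
  unfolding plate_def by measurable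

text \<open>
  About \<open>2 ^ k\<close> disjoint translates of the plate fit into a ball of radius \<open>3 / 2 ^ k\<close>.
\<close>
lemma emeasure_plate_le:
  "emeasure lborel (plate k :: (real ^ 'n) set) \<le>
     ennreal (unit_ball_vol (real CARD('n)) * 3 ^ CARD('n) * (1 / 2) ^ (k * (CARD('n) + 1)))"
proof -
  \<comment> \<open>Any coordinate direction is transversal to the plate: the coordinate sum of
    \<open>axis a 1\<close> is 1.\<close>
  obtain a :: 'n where True by simp
  define h :: real where "h = (1 / 2) ^ k"
  have h: "0 < h" "h \<le> 1" "(1 / 4) ^ k = h * h" "h * 2 ^ k = 1"
    by (auto simp: h_def power_le_one power_mult_distrib[symmetric])
  \<comment> \<open>Steps of \<open>2 * (h * h)\<close> in the coordinate sum separate open slabs of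
    half-width \<open>h * h\<close>, and \<open>2 ^ k\<close> such steps cover a length of only
    \<open>2 * h\<close>.\<close>
  define c where "c j = (2 * (h * h) * real j) *\<^sub>R (axis a 1 :: real ^ 'n)" for j :: nat
  have c: "(\<Sum>i\<in>UNIV. c j $ i) = 2 * (h * h) * real j" "norm (c j) = 2 * (h * h) * real j" for j
    using h by (simp_all add: c_def axis_def flip: sum_distrib_left)
      (simp_all flip: axis_def)
  define V where "V = unit_ball_vol (real CARD('n))"
  have V: "V > 0" by (simp add: V_def)
  have "of_nat (2 ^ k) * emeasure lborel (plate k :: (real ^ 'n) set)
      \<le> emeasure lborel (ball (0 :: real ^ 'n) (3 * h))"
  proof (rule emeasure_disjoint_translates_le)
    fix i j and x :: "real ^ 'n"
    assume ij: "i < j" and x: "x - c i \<in> plate k" "x - c j \<in> plate k"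
    have "\<bar>(\<Sum>l\<in>UNIV. x $ l) - 2 * (h * h) * real i\<bar> < h * h"
         "\<bar>(\<Sum>l\<in>UNIV. x $ l) - 2 * (h * h) * real j\<bar> < h * h"
      using x by (simp_all add: plate_def sum_subtractf c h)
    then have "2 * (h * h) * (real j - real i) < 2 * (h * h)"
      by (simp add: algebra_simps)
    moreover have "2 * (h * h) * (real j - real i) \<ge> 2 * (h * h) * 1"
      using ij by (intro mult_left_mono) auto
    ultimately show False by simp
  next
    fix j and x :: "real ^ 'n"
    assume j: "j < 2 ^ k" and x: "x - c j \<in> plate k"
    have "norm (c j) \<le> 2 * (h * h) * 2 ^ k"
      unfolding c using j by (intro mult_left_mono) (auto simp flip: of_nat_power simp del: of_nat_power)
    also have "\<dots> = 2 * h"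
      using h(4) by (simp add: mult.assoc)
    finally have "norm (c j) \<le> 2 * h" .
    moreover have "norm (x - c j) < h"
      using x by (simp add: plate_def h_def)
    ultimately show "x \<in> ball 0 (3 * h)"
      using norm_triangle_ineq[of "x - c j" "c j"] by simp
  qed auto
  also have "\<dots> = ennreal (V * 3 ^ CARD('n) * h ^ CARD('n))"
    using h by (simp add: emeasure_ball V_def power_mult_distrib mult.assoc)
  finally have "ennreal h * (of_nat (2 ^ k) * emeasure lborel (plate k :: (real ^ 'n) set))
      \<le> ennreal h * ennreal (V * 3 ^ CARD('n) * h ^ CARD('n))"
    by (rule mult_left_mono) simp
  also have "ennreal h * (of_nat (2 ^ k) * emeasure lborel (plate k :: (real ^ 'n) set)) =
      ennreal (h * 2 ^ k) * emeasure lborel (plate k :: (real ^ 'n) set)"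
  proof -
    have "of_nat (2 ^ k) = ennreal (2 ^ k)"
      by (metis ennreal_of_nat_eq_real_of_nat of_nat_numeral of_nat_power)
    then show ?thesis
      using h(1) by (simp only: ennreal_mult less_imp_le zero_le_power zero_le_numeral mult.assoc)
  qed
  also have "\<dots> = emeasure lborel (plate k :: (real ^ 'n) set)"
    by (simp add: h(4))
  also have "ennreal h * ennreal (V * 3 ^ CARD('n) * h ^ CARD('n)) =
      ennreal (V * 3 ^ CARD('n) * (1 / 2) ^ (k * (CARD('n) + 1)))"
    using h V by (simp add: ennreal_mult[symmetric] h_def power_add power_mult mult_ac)
  finally show ?thesis by (simp add: V_def)
qed

lemma plate_antimono: "j \<le> k \<Longrightarrow> plate k \<subseteq> plate j"
  unfolding plate_def
  by (auto intro: less_le_trans[OF _ power_decreasing])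

section \<open>The singular function and its integrability\<close>

text \<open>The last term dominates as in a geometric series. From \<open>k = 1\<close> on, the
  bound for \<open>k\<close> is at most 3/4 of the bound for \<open>Suc k\<close>, which leaves room
  for the new term.\<close>

lemma sum_power_over_Suc_le:
  fixes q :: real
  assumes "2 \<le> q"
  shows "(\<Sum>j\<le>k. q ^ j / (real j + 1)) \<le> 4 * q ^ k / (real k + 1)"
proof (induction k)
  case 0
  then show ?case by simp
next
  case (Suc k)
  show ?case
  proof (cases "k = 0")
    case True
    then show ?thesis using assms by simp
  next
    case False
    have "4 * q ^ k / (real k + 1) = q ^ k * (4 / (real k + 1))"
      by simp
    also have "\<dots> \<le> q ^ k * (6 / (real k + 2))"
      using False assms by (intro mult_left_mono) (auto simp: field_simps)
    also have "\<dots> = 2 * q ^ k * (3 / (real k + 2))"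
      by simp
    also have "\<dots> \<le> q * q ^ k * (3 / (real k + 2))"
      using assms by (intro mult_right_mono) auto
    finally have "4 * q ^ k / (real k + 1) \<le> 3 * q ^ Suc k / (real k + 2)"
      by (simp add: mult_ac)
    moreover have "3 * q ^ Suc k / (real k + 2) + q ^ Suc k / (real k + 2) = 4 * q ^ Suc k / (real k + 2)"
      by (simp flip: add_divide_distrib)
    moreover have e: "real (Suc k) + 1 = real k + 2"
      by simp
    ultimately show ?thesis
      using Suc.IH unfolding sum.atMost_Suc e by linarith
  qed
qed

text \<open>The index starts at 0, hence the divisor \<open>k + 1\<close>. Values in
  \<open>ennreal\<close> admit the value \<infinity> at the origin, which lies in every
  plate.\<close>

definition spike :: "real ^ 'n \<Rightarrow> ennreal" where
  "spike z = (\<Sum>k. ennreal ((2 ^ (CARD('n) - 1)) ^ k / (real k + 1)) * indicator (plate k) z)"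

lemma spike_borel [measurable]: "spike \<in> borel_measurable borel"
  unfolding spike_def by measurable

text \<open>The plates are nested and shrink to the origin, so any other point lies in an initial
  segment of them only.\<close>

lemma spike_eq_sum:
  fixes z :: "real ^ 'n"
  assumes "z \<noteq> 0"
  obtains N where "\<And>j. z \<in> plate j \<longleftrightarrow> j < N"
    and "spike z = ennreal (\<Sum>j<N. (2 ^ (CARD('n) - 1)) ^ j / (real j + 1))"
proof -
  obtain k where "(1 / 2 :: real) ^ k < norm z"
    using real_arch_pow_inv[of "norm z" "1 / 2"] assms by auto
  then have ex: "z \<notin> plate k"
    by (simp add: plate_def)
  define N where "N = (LEAST j. z \<notin> plate j)"
  have N: "z \<in> plate j \<longleftrightarrow> j < N" for j
  proof
    have "z \<notin> plate N"
      unfolding N_def using ex by (rule LeastI)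
    then show "z \<in> plate j \<Longrightarrow> j < N"
      using plate_antimono[of N j] by (cases "j < N") auto
  next
    show "j < N \<Longrightarrow> z \<in> plate j"
      unfolding N_def by (drule not_less_Least) simp
  qed
  have "spike z = (\<Sum>j<N. ennreal ((2 ^ (CARD('n) - 1)) ^ j / (real j + 1)) * indicator (plate j) z)"
    unfolding spike_def by (rule suminf_finite) (auto simp: N)
  also have "\<dots> = (\<Sum>j<N. ennreal ((2 ^ (CARD('n) - 1)) ^ j / (real j + 1)))"
    by (intro sum.cong) (auto simp: N)
  also have "\<dots> = ennreal (\<Sum>j<N. (2 ^ (CARD('n) - 1)) ^ j / (real j + 1))"
    by (intro sum_ennreal) auto
  finally show ?thesis
    using that N by blast
qed

text \<open>
  Away from the origin \<open>spike\<close> is \<open>0\<close> or at least \<open>1\<close>, so its powers increase with the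
  exponent; this reduces \<open>p\<close> to the critical exponent.
\<close>
lemma spike_powr_le:
  fixes z :: "real ^ 'n"
  assumes n: "CARD('n) \<ge> 2" and z: "z \<noteq> 0" and ps: "p \<le> s" "0 < s"
  shows "ennreal (enn2real (spike z) powr p) \<le>
    (\<Sum>k. ennreal ((4 * (2 ^ (CARD('n) - 1)) ^ k / (real k + 1)) powr s) * indicator (plate k) z)"
proof -
  define q :: real where "q = 2 ^ (CARD('n) - 1)"
  have q: "2 \<le> q"
    using n power_increasing[of 1 "CARD('n) - 1" "2 :: real"] by (simp add: q_def)
  obtain N where N: "\<And>j. z \<in> plate j \<longleftrightarrow> j < N"
    and eq: "spike z = ennreal (\<Sum>j<N. q ^ j / (real j + 1))"
    using spike_eq_sum[OF z] unfolding q_def by metis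
  show ?thesis
  proof (cases N)
    case 0
    \<comment> \<open>No plate contains \<open>z\<close>, so \<open>spike z\<close> is 0, and
      \<open>0 powr p\<close> is 0 for every real \<open>p\<close>.\<close>
    then show ?thesis using eq by simp
  next
    case (Suc k)
    define v where "v = (\<Sum>j\<le>k. q ^ j / (real j + 1))"
    have v: "spike z = ennreal v"
      using eq by (simp add: Suc v_def lessThan_Suc_atMost)
    have "(\<Sum>j\<in>{0}. q ^ j / (real j + 1)) \<le> v"
      unfolding v_def using q by (intro sum_mono2) auto
    then have "1 \<le> v" by simp
    have "enn2real (spike z) powr p \<le> v powr s"
      using \<open>1 \<le> v\<close> ps by (simp add: v powr_mono)
    also have "\<dots> \<le> (4 * q ^ k / (real k + 1)) powr s"
      unfolding v_def using q \<open>0 < s\<close>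
      by (intro powr_mono2 sum_power_over_Suc_le sum_nonneg) auto
    finally have "ennreal (enn2real (spike z) powr p)
        \<le> (\<Sum>k\<in>{k}. ennreal ((4 * q ^ k / (real k + 1)) powr s) * indicator (plate k) z)"
      by (simp add: N Suc ennreal_leI)
    also have "\<dots> \<le> (\<Sum>k. ennreal ((4 * q ^ k / (real k + 1)) powr s) * indicator (plate k) z)"
      by (intro sum_le_suminf) auto
    finally show ?thesis by (simp add: q_def)
  qed
qed

lemma spike_in_Lp_space:
  fixes p :: real
  assumes n: "CARD('n::finite) \<ge> 2" and p: "p \<le> (real CARD('n) + 1) / (real CARD('n) - 1)"
  shows "(\<lambda>z. enn2real (spike z)) \<in> (Lp_space p :: (real ^ 'n \<Rightarrow> real) set)"
proof -
  define s where "s = (real CARD('n) + 1) / (real CARD('n) - 1)"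
  have s: "1 < s" using n by (simp add: s_def field_simps)
  define m where "m = CARD('n) - 1"
  have m: "CARD('n) = m + 1" "1 \<le> m" using n by (auto simp: m_def)
  \<comment> \<open>This makes the \<open>s\<close>-th power of \<open>(2 ^ m) ^ k\<close> equal to
    \<open>2 ^ (k * (CARD('n) + 1))\<close>, the exact inverse of the decay of the plate
    volume.\<close>
  have ms: "real m * s = real (m + 2)"
    using m by (simp add: s_def)
  define K where "K = 4 powr s * (unit_ball_vol (real CARD('n)) * 3 ^ CARD('n))"
  have coeff: "(4 * (2 ^ m) ^ k / (real k + 1)) powr s *
      (unit_ball_vol (real CARD('n)) * 3 ^ CARD('n) * (1 / 2) ^ (k * (CARD('n) + 1))) =
      K * real (Suc k) powr - s" for k
  proof -
    have "((2 ^ m) ^ k :: real) powr s = 2 powr (real k * (real m * s))"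
      by (simp add: powr_powr mult_ac flip: power_mult powr_realpow)
    also have "\<dots> = 2 ^ (k * (CARD('n) + 1))"
      unfolding ms m(1) by (simp add: algebra_simps flip: powr_realpow)
    finally have "((2 ^ m) ^ k :: real) powr s * (1 / 2) ^ (k * (CARD('n) + 1)) = 1"
      by (simp flip: power_mult_distrib)
    moreover have "(4 * (2 ^ m) ^ k / (real k + 1)) powr s =
        4 powr s * ((2 ^ m) ^ k) powr s * real (Suc k) powr - s"
      by (simp add: powr_mult powr_divide powr_minus_divide add.commute)
    ultimately show ?thesis
      by (simp add: K_def mult_ac)
  qed
  have "(\<integral>\<^sup>+ z. ennreal (enn2real (spike z) powr p) \<partial>(lborel :: (real ^ 'n) measure))
      \<le> (\<integral>\<^sup>+ z. (\<Sum>k. ennreal ((4 * (2 ^ m) ^ k / (real k + 1)) powr s) * indicator (plate k) z)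
          \<partial>(lborel :: (real ^ 'n) measure))"
  proof (rule nn_integral_mono_AE)
    show "AE z in (lborel :: (real ^ 'n) measure). ennreal (enn2real (spike z) powr p)
        \<le> (\<Sum>k. ennreal ((4 * (2 ^ m) ^ k / (real k + 1)) powr s) * indicator (plate k) z)"
      using AE_lborel_singleton[of "0 :: real ^ 'n"]
    proof eventually_elim
      case (elim z)
      then show ?case
        using spike_powr_le[OF n elim, of p s] p s by (simp add: m_def s_def)
    qed
  qed
  also have "\<dots> = (\<Sum>k. ennreal ((4 * (2 ^ m) ^ k / (real k + 1)) powr s) *
      emeasure lborel (plate k :: (real ^ 'n) set))"
    by (subst nn_integral_suminf) (auto intro!: suminf_cong nn_integral_cmult_indicator)
  also have "\<dots> \<le> (\<Sum>k. ennreal (K * real (Suc k) powr - s))"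
  proof (intro suminf_le)
    fix k
    have "ennreal ((4 * (2 ^ m) ^ k / (real k + 1)) powr s) * emeasure lborel (plate k :: (real ^ 'n) set)
        \<le> ennreal ((4 * (2 ^ m) ^ k / (real k + 1)) powr s) *
          ennreal (unit_ball_vol (real CARD('n)) * 3 ^ CARD('n) * (1 / 2) ^ (k * (CARD('n) + 1)))"
      by (intro mult_left_mono emeasure_plate_le) simp
    also have "\<dots> = ennreal (K * real (Suc k) powr - s)"
      unfolding coeff[symmetric] by (rule ennreal_mult[symmetric]) auto
    finally show "ennreal ((4 * (2 ^ m) ^ k / (real k + 1)) powr s) * emeasure lborel (plate k :: (real ^ 'n) set)
        \<le> ennreal (K * real (Suc k) powr - s)" .
  qed auto
  also have "\<dots> < \<infinity>"
  proof -
    have "summable (\<lambda>k. real k powr - s)"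
      using s by (simp add: summable_real_powr_iff)
    then have "summable (\<lambda>k. K * real (Suc k) powr - s)"
      by (intro summable_mult) (subst summable_Suc_iff)
    moreover have "0 \<le> K"
      by (simp add: K_def)
    ultimately have "(\<Sum>k. ennreal (K * real (Suc k) powr - s)) \<noteq> top"
      by (intro ennreal_suminf_neq_top) auto
    then show ?thesis by (simp add: top.not_eq_extremum)
  qed
  finally have "integrable lborel (\<lambda>z :: real ^ 'n. enn2real (spike z) powr p)"
    by (intro integrableI_bounded) auto
  then show ?thesis
    by (simp add: Lp_space_def)
qed

section \<open>Divergent averages over tangent ellipsoids\<close>

text \<open>The cone over a point lies in a line, a null set in dimension at least 2. This discards
  the one direction in which the ellipsoid meets the singularity.\<close>

lemma AE_sphere_measure_neq:
  assumes "CARD('n::finite) \<ge> 2"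
  shows "AE \<omega> in sphere_measure. \<omega> \<noteq> (u :: real ^ 'n)"
proof -
  have "{x \<in> ball 0 1. sgn x \<in> {u}} \<subseteq> span {u}"
  proof
    fix x assume "x \<in> {x \<in> ball 0 1. sgn x \<in> {u}}"
    moreover have "x = norm x *\<^sub>R sgn x"
      by (cases "x = 0") (simp_all add: sgn_div_norm)
    ultimately have "x = norm x *\<^sub>R u"
      by simp
    then show "x \<in> span {u}"
      by (metis span_base span_scale singletonI)
  qed
  moreover have "negligible (span {u})"
    using assms dim_le_card[of "{u}" "{u}"] by (intro negligible_lowdim) (simp add: span_base)
  ultimately have "negligible {x \<in> ball 0 1. sgn x \<in> {u}}"
    by (rule negligible_subset[rotated])
  moreover have "{x \<in> ball 0 1. sgn x \<in> {u}} \<in> sets borel"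
    by measurable
  ultimately have "emeasure lborel {x \<in> ball 0 1. sgn x \<in> {u}} = 0"
    by (simp add: negligible_iff_null_sets null_sets_def)
  then have "emeasure sphere_measure {u} = 0"
    by (subst emeasure_sphere_measure) auto
  then show ?thesis
    by (intro AE_I[of _ _ "{u}"]) (auto simp: sphere_measure_def)
qed

text \<open>
  At the point \<open>dilation (S u) u\<close> the ellipsoid is tangent to the hyperplane on which the
  coordinate sum is constant, hence the quadratic smallness of the coordinate sum of \<open>z\<close>.
\<close>
lemma dilation_diff_in_plate:
  fixes u \<omega> :: "real ^ 'n"
  assumes u: "norm u = 1" and \<omega>: "norm \<omega> = 1" and S: "0 < S"
    and close: "norm (\<omega> - u) < (1 / 2) ^ k / max S 1"
  shows "dilation (S *\<^sub>R u) u - dilation (S *\<^sub>R u) \<omega> \<in> plate k"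
proof -
  let ?z = "dilation (S *\<^sub>R u) u - dilation (S *\<^sub>R u) \<omega>"
  have A: "max S 1 * norm (\<omega> - u) < (1 / 2) ^ k"
    using close by (simp add: field_simps)
  have "norm ?z \<le> norm (S *\<^sub>R (\<omega> - u))"
  proof (rule norm_le_componentwise_cart)
    fix i
    have "\<bar>u $ i\<bar> \<le> 1"
      using component_le_norm_cart[of u i] u by simp
    then have "S * \<bar>u $ i\<bar> * \<bar>\<omega> $ i - u $ i\<bar> \<le> S * 1 * \<bar>\<omega> $ i - u $ i\<bar>"
      using S by (intro mult_right_mono mult_left_mono) auto
    moreover have "?z $ i = S * u $ i * (u $ i - \<omega> $ i)"
      by (simp add: dilation_def algebra_simps)
    ultimately show "norm (?z $ i) \<le> norm ((S *\<^sub>R (\<omega> - u)) $ i)"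
      using S by (simp add: abs_mult abs_minus_commute)
  qed
  also have "\<dots> \<le> max S 1 * norm (\<omega> - u)"
    using S by (auto intro: mult_right_mono)
  finally have 1: "norm ?z < (1 / 2) ^ k"
    using A by simp
  \<comment> \<open>Tangency enters here: for unit vectors,
    \<open>u \<bullet> u - u \<bullet> \<omega>\<close> is half the squared distance, with no linear
    term.\<close>
  have "(\<Sum>i\<in>UNIV. ?z $ i) = S * (u \<bullet> u - u \<bullet> \<omega>)"
    by (simp add: dilation_def inner_vec_def sum_subtractf sum_distrib_left algebra_simps)
  also have "\<dots> = S * (norm (\<omega> - u))\<^sup>2 / 2"
    using u \<omega> by (simp add: power2_norm_eq_inner inner_diff norm_eq_1 inner_commute)
  finally have sum: "(\<Sum>i\<in>UNIV. ?z $ i) = S * (norm (\<omega> - u))\<^sup>2 / 2" .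
  \<comment> \<open>The factor \<open>max S 1\<close> serves both bounds: it dominates
    \<open>S\<close>, and its square dominates \<open>S / 2\<close>.\<close>
  have "S * (norm (\<omega> - u))\<^sup>2 / 2 \<le> (max S 1)\<^sup>2 * (norm (\<omega> - u))\<^sup>2"
  proof -
    have "S / 2 \<le> max S 1 * 1" using S by simp
    also have "\<dots> \<le> max S 1 * max S 1" by (intro mult_left_mono) auto
    finally have "S / 2 * (norm (\<omega> - u))\<^sup>2 \<le> max S 1 * max S 1 * (norm (\<omega> - u))\<^sup>2"
      by (intro mult_right_mono) auto
    then show ?thesis by (simp add: power2_eq_square)
  qed
  also have "\<dots> = (max S 1 * norm (\<omega> - u))\<^sup>2"
    by (simp add: power_mult_distrib)
  also have "\<dots> < ((1 / 2) ^ k)\<^sup>2"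
    using A by (intro power_strict_mono) auto
  also have "\<dots> = (1 / 4) ^ k"
    by (simp add: power2_eq_square flip: power_mult_distrib)
  finally have "\<bar>\<Sum>i\<in>UNIV. ?z $ i\<bar> < (1 / 4) ^ k"
    unfolding sum using S by simp
  with 1 show ?thesis
    unfolding plate_def by blast
qed

text \<open>A cap of radius \<open>(1 / 2) ^ k / max S 1\<close> around \<open>u\<close> is mapped
  into the \<open>k\<close>-th plate. Its measure cancels the weight \<open>(2 ^ m) ^ k\<close> and
  leaves a multiple of the harmonic series.\<close>

lemma nn_integral_spike_sphere:
  fixes u :: "real ^ 'n"
  assumes u: "norm u = 1" and S: "0 < S"
  shows "(\<integral>\<^sup>+ \<omega>. spike (dilation (S *\<^sub>R u) u - dilation (S *\<^sub>R u) \<omega>) \<partial>sphere_measure) = \<infinity>"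
proof -
  define m where "m = CARD('n) - 1"
  define A where "A = max S 1"
  have A: "1 \<le> A" by (simp add: A_def)
  \<comment> \<open>The part of the cap bound that is independent of \<open>k\<close>.\<close>
  define K where "K = 1 / (A ^ m * 8 ^ CARD('n))"
  have K: "K > 0" using A by (simp add: K_def)
  let ?z = "\<lambda>\<omega>. dilation (S *\<^sub>R u) u - dilation (S *\<^sub>R u) \<omega>"
  have [measurable_cong]: "sets sphere_measure = sets (borel :: (real ^ 'n) measure)"
    by (simp add: sphere_measure_def)
  have sp: "AE \<omega> in (sphere_measure :: (real ^ 'n) measure). norm \<omega> = 1"
  proof -
    interpret prob_space "sphere_measure :: (real ^ 'n) measure"
      by (rule prob_space_sphere_measure)
    have "AE \<omega> in (sphere_measure :: (real ^ 'n) measure). \<omega> \<in> sphere 0 1"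
      by (rule AE_prob_1) (simp add: measure_def emeasure_sphere_measure_sphere)
    then show ?thesis by simp
  qed
  have cap: "ennreal (K / (2 ^ m) ^ k) \<le> (\<integral>\<^sup>+ \<omega>. indicator (plate k) (?z \<omega>) \<partial>sphere_measure)" for k
  proof -
    define \<epsilon> where "\<epsilon> = (1 / 2) ^ k / A"
    have \<epsilon>: "0 < \<epsilon>" "\<epsilon> \<le> 1"
      using A power_le_one[of "1 / 2 :: real" k] by (auto simp: \<epsilon>_def intro!: divide_le_eq_1_pos[THEN iffD2])
    have "K / (2 ^ m) ^ k = \<epsilon> ^ m / 8 ^ CARD('n)"
      by (simp add: K_def \<epsilon>_def power_divide power_mult_distrib mult_ac flip: power_mult)
    then have "ennreal (K / (2 ^ m) ^ k) \<le> emeasure sphere_measure {\<omega>. norm (\<omega> - u) < \<epsilon>}"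
      using sphere_measure_cap_ge[OF u \<epsilon>] by (simp add: m_def)
    also have "\<dots> = (\<integral>\<^sup>+ \<omega>. indicator {\<omega>. norm (\<omega> - u) < \<epsilon>} \<omega> \<partial>sphere_measure)"
      by (rule nn_integral_indicator[symmetric]) measurable
    also have "\<dots> \<le> (\<integral>\<^sup>+ \<omega>. indicator (plate k) (?z \<omega>) \<partial>sphere_measure)"
    proof (rule nn_integral_mono_AE)
      show "AE \<omega> in sphere_measure. indicator {\<omega>. norm (\<omega> - u) < \<epsilon>} \<omega> \<le> (indicator (plate k) (?z \<omega>) :: ennreal)"
        using sp
      proof eventually_elim
        case (elim \<omega>)
        then show ?case
          using dilation_diff_in_plate[OF u elim S, of k]
          by (auto simp: indicator_def \<epsilon>_def A_def)
      qed
    qed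
    finally show ?thesis .
  qed
  have "\<infinity> = (\<Sum>k. ennreal (K / (real k + 1)))"
  proof (rule ccontr)
    assume "\<infinity> \<noteq> (\<Sum>k. ennreal (K / (real k + 1)))"
    then have "summable (\<lambda>k. K / (real k + 1))"
      using K by (intro summable_suminf_not_top) auto
    then have "summable (\<lambda>k. inverse K * (K / (real k + 1)))"
      by (rule summable_mult)
    then have "summable (\<lambda>k. inverse (real (Suc k)))"
      using K by (simp add: field_simps inverse_eq_divide)
    then show False
      using not_summable_harmonic[where 'a = real] summable_Suc_iff[of "\<lambda>k. inverse (real k)"]
      by simp
  qed
  also have "\<dots> \<le> (\<Sum>k. ennreal ((2 ^ m) ^ k / (real k + 1)) *
      (\<integral>\<^sup>+ \<omega>. indicator (plate k) (?z \<omega>) \<partial>sphere_measure))"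
  proof (intro suminf_le)
    fix k
    have "ennreal (K / (real k + 1)) = ennreal ((2 ^ m) ^ k / (real k + 1)) * ennreal (K / (2 ^ m) ^ k)"
      using K by (subst ennreal_mult[symmetric]) auto
    also have "\<dots> \<le> ennreal ((2 ^ m) ^ k / (real k + 1)) *
        (\<integral>\<^sup>+ \<omega>. indicator (plate k) (?z \<omega>) \<partial>sphere_measure)"
      by (intro mult_left_mono cap) auto
    finally show "ennreal (K / (real k + 1)) \<le> ennreal ((2 ^ m) ^ k / (real k + 1)) *
        (\<integral>\<^sup>+ \<omega>. indicator (plate k) (?z \<omega>) \<partial>sphere_measure)" .
  qed auto
  also have "\<dots> = (\<integral>\<^sup>+ \<omega>. spike (?z \<omega>) \<partial>sphere_measure)"
    unfolding spike_def m_def[symmetric]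
    by (subst nn_integral_suminf) (auto simp: nn_integral_cmult)
  finally show ?thesis
    by (simp add: top_unique)
qed

lemma strong_spherical_maximal_spike:
  fixes x :: "real ^ 'n"
  assumes n: "CARD('n) \<ge> 2" and x: "\<And>i. 0 < x $ i"
  shows "strong_spherical_maximal (\<lambda>z. enn2real (spike z)) x = \<infinity>"
proof -
  define S where "S = (\<Sum>i\<in>UNIV. x $ i)"
  have S: "0 < S"
    unfolding S_def using x by (intro sum_pos) auto
  \<comment> \<open>The unit vector with \<open>S * u $ i * u $ i = x $ i\<close>: the semi-axes
    \<open>S * u $ i\<close> are \<open>sqrt (S * x $ i)\<close>, and the ellipsoid centred at
    \<open>x\<close> reaches the origin at \<omega> = \<open>u\<close>.\<close>
  define u :: "real ^ 'n" where "u = (\<chi> i. sqrt (x $ i / S))"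
  define r where "r = S *\<^sub>R u"
  have pos: "0 < u $ i" for i
    using x S by (simp add: u_def)
  have u2: "u $ i * u $ i = x $ i / S" for i
    using x[of i] S by (simp add: u_def)
  have "u \<bullet> u = 1"
    using S by (simp add: inner_vec_def u2 S_def flip: sum_divide_distrib)
  then have u: "norm u = 1"
    by (simp add: norm_eq_1)
  have x_eq: "x = dilation r u"
    using S by (simp add: vec_eq_iff dilation_def r_def mult.assoc u2)
  have [measurable_cong]: "sets sphere_measure = sets (borel :: (real ^ 'n) measure)"
    by (simp add: sphere_measure_def)
  have "(\<integral>\<^sup>+ y. ennreal (enn2real (spike (x - y))) \<partial>dilated_sphere_measure r) =
      (\<integral>\<^sup>+ \<omega>. ennreal (enn2real (spike (x - dilation r \<omega>))) \<partial>sphere_measure)"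
    unfolding dilated_sphere_measure_def by (rule nn_integral_distr) measurable
  also have "\<dots> = (\<integral>\<^sup>+ \<omega>. spike (x - dilation r \<omega>) \<partial>sphere_measure)"
    using AE_sphere_measure_neq[OF n, of u]
  proof (intro nn_integral_cong_AE, eventually_elim)
    \<comment> \<open>Off the origin \<open>spike\<close> is finite, so \<open>enn2real\<close>
      loses nothing; at the origin it would turn \<infinity> into 0.\<close>
    case (elim \<omega>)
    then obtain i where "u $ i \<noteq> \<omega> $ i"
      by (metis vec_eq_iff)
    then have "(x - dilation r \<omega>) $ i \<noteq> 0"
      using S pos[of i] by (simp add: x_eq dilation_def r_def)
    then have "x - dilation r \<omega> \<noteq> 0"
      by (metis zero_index)
    then obtain N where "spike (x - dilation r \<omega>) =
        ennreal (\<Sum>j<N. (2 ^ (CARD('n) - 1)) ^ j / (real j + 1))"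
      by (rule spike_eq_sum)
    then show ?case
      by (simp add: sum_nonneg)
  qed
  also have "\<dots> = \<infinity>"
    using nn_integral_spike_sphere[OF u S] by (simp add: x_eq r_def)
  \<comment> \<open>The function is nonnegative, so its negative part integrates to 0 and the
    undefined case of \<open>ext_integral\<close> does not arise.\<close>
  finally have "measure_convolution (\<lambda>z. enn2real (spike z)) (dilated_sphere_measure r) x = \<infinity>"
    by (simp add: measure_convolution_def ext_integral_def ennreal_neg)
  moreover have "r \<in> {r. \<forall>i. 0 < r $ i}"
    using S pos by (simp add: r_def)
  ultimately have "\<infinity> \<le> strong_spherical_maximal (\<lambda>z. enn2real (spike z)) x"
    unfolding strong_spherical_maximal_def by (intro SUP_upper2[of r]) auto
  then show ?thesis by simp
qed

section \<open>Conclusion on the open unit cube\<close>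

theorem lemmaA1:
  fixes p :: real
  assumes "CARD('n::finite) \<ge> 2"
    and "1 \<le> p"
    and "p \<le> (real CARD('n) + 1) / (real CARD('n) - 1)"
  shows "\<exists>f \<in> (Lp_space p :: (real ^ 'n \<Rightarrow> real) set). \<exists>F \<in> sets (lebesgue :: (real ^ 'n) measure).
    emeasure lebesgue F > 0 \<and> (\<forall>x \<in> F. strong_spherical_maximal f x = \<infinity>)"
proof (intro bexI conjI ballI)
  show "(\<lambda>z. enn2real (spike z)) \<in> (Lp_space p :: (real ^ 'n \<Rightarrow> real) set)"
    using assms by (intro spike_in_Lp_space)
  \<comment> \<open>The open unit cube lies in the open positive orthant, where the tangent
    ellipsoid exists.\<close>
  show "strong_spherical_maximal (\<lambda>z. enn2real (spike z)) x = \<infinity>"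
    if "x \<in> box 0 (\<chi> i. 1)" for x :: "real ^ 'n"
    using that assms(1) by (intro strong_spherical_maximal_spike) (auto simp: mem_box_cart)
  show "box 0 (\<chi> i. 1) \<in> sets (lebesgue :: (real ^ 'n) measure)"
    by simp
  have "\<not> negligible (box 0 (\<chi> i. 1) :: (real ^ 'n) set)"
    by (intro open_not_negligible) (auto simp: interval_ne_empty_cart)
  then show "emeasure lebesgue (box 0 (\<chi> i. 1) :: (real ^ 'n) set) > 0"
    by (simp add: negligible_iff_emeasure0 zero_less_iff_neq_zero)
qed

end
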